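(* Suppose that $X$ is a Banach space structure containing a subspace isomorphic to $c_0$. Then $X$ has the independence property (IP).
   Context: A Banach space is regarded as a structure of continuous logic by means of its unit ball: elements below range over the unit ball of $X$. A Banach space $X$ has IP if the formula $\phi(x,y)=\|x+y\|$ has IP on $X$, i.e. there are a sequence $(a_n)$ in the unit ball of $X$ and reals $r>s$ such that for all finite disjoint $E,F\subseteq\mathbb N$ there is $b$ in the unit ball of $X$ with $\|a_n+b\|\leqslant s$ for all $n\in E$ and $\|a_n+b\|\geqslant r$ for all $n\in F$. "Isomorphic" means linearly homeomorphic. *)

theory Defs
  imports "HOL-Analysis.Analysis"
begin

text \<open>
  The sequence space \<open>c\<^sub>0\<close>. Since \<open>nat\<close> carries the discrete topology, \<open>nat \<Rightarrow>\<^sub>C real\<close> is the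
  Banach space of all bounded real sequences under the supremum norm.
\<close>

definition c0 :: "(nat \<Rightarrow>\<^sub>C real) set" where
  "c0 = {x. apply_bcontfun x \<longlonglongrightarrow> 0}"

lemma norm_bounded_sequence: "norm x = (SUP n. \<bar>apply_bcontfun x n\<bar>)"
  for x :: "nat \<Rightarrow>\<^sub>C real"
  unfolding norm_bcontfun_def dist_bcontfun_def by simp

lemma in_range_c0:
  fixes f :: "nat \<Rightarrow> real"
  assumes "f \<longlonglongrightarrow> 0"
  obtains x where "x \<in> c0" "apply_bcontfun x = f"
proof -
  have "bounded (range f)"
    using assms convergent_imp_bounded by blast
  then have "f \<in> bcontfun"
    by (simp add: bcontfun_def)
  then have "apply_bcontfun (Bcontfun f) = f"
    by (rule Bcontfun_inverse)
  with assms show thesis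
    by (intro that[of "Bcontfun f"]) (auto simp: c0_def)
qed

lemma subspace_c0: "subspace c0"
  unfolding subspace_def c0_def
  by (auto simp: plus_bcontfun.rep_eq scaleR_bcontfun.rep_eq zero_bcontfun.rep_eq
      intro: tendsto_add_zero tendsto_mult_right_zero)

definition linearly_homeomorphic ::
    "'a::real_normed_vector set \<Rightarrow> 'b::real_normed_vector set \<Rightarrow> bool" where
  "linearly_homeomorphic A B \<longleftrightarrow>
     (\<exists>f g. homeomorphism A B f g \<and>
        (\<forall>x\<in>A. \<forall>y\<in>A. f (x + y) = f x + f y) \<and>
        (\<forall>c. \<forall>x\<in>A. f (c *\<^sub>R x) = c *\<^sub>R f x))"

definition formula_has_IP :: "'a set \<Rightarrow> ('a \<Rightarrow> 'a \<Rightarrow> real) \<Rightarrow> bool" where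
  "formula_has_IP M \<phi> \<longleftrightarrow>
     (\<exists>(a :: nat \<Rightarrow> 'a) (r :: real) (s :: real).
        range a \<subseteq> M \<and> r > s \<and>
        (\<forall>E F. finite E \<and> finite F \<and> E \<inter> F = {} \<longrightarrow>
           (\<exists>b\<in>M. (\<forall>n\<in>E. \<phi> (a n) b \<le> s) \<and> (\<forall>n\<in>F. \<phi> (a n) b \<ge> r))))"

definition banach_has_IP :: "'a::banach itself \<Rightarrow> bool" where
  "banach_has_IP _ \<longleftrightarrow> formula_has_IP (cball (0 :: 'a) 1) (\<lambda>x y. norm (x + y))"

end

theory Submission
  imports Defs
begin

text \<open>
  James's distortion argument: among the combinations with coefficients in \<open>[-1, 1]\<close> of a tail of
  the image of the unit vector basis of \<open>c\<^sub>0\<close>, the suprema of the norms decrease to a positive limit,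
  so far out they nearly agree. Disjoint blocks that nearly attain the supremum, once normalised,
  form a sequence \<open>a\<close> with \<open>\<parallel>a n\<parallel> > 3/4\<close> all of whose combinations with coefficients in \<open>[-1, 1]\<close>
  have norm at most \<open>1\<close>. With \<open>b = (\<Sum>k\<in>F. a k) - (\<Sum>k\<in>E. a k)\<close> we get \<open>\<parallel>a n + b\<parallel> \<le> 1\<close> for
  \<open>n \<in> E\<close>, while for \<open>n \<in> F\<close> the vectors \<open>a n + b\<close> and \<open>2 a n - b\<close> add up to \<open>3 a n\<close> and the second
  has norm at most \<open>1\<close>, so that \<open>\<parallel>a n + b\<parallel> \<ge> 3 \<cdot> 3/4 - 1 > 1\<close>.
\<close>

lemma formula_has_IP_norm_add:
  fixes a :: "nat \<Rightarrow> 'a::real_normed_vector"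
  assumes upper: "\<And>G t. finite G \<Longrightarrow> (\<And>k. \<bar>t k\<bar> \<le> 1) \<Longrightarrow> norm (\<Sum>k\<in>G. t k *\<^sub>R a k) \<le> 1"
    and lower: "\<And>n. \<theta> \<le> norm (a n)" and \<theta>: "\<theta> > 2/3"
  shows "formula_has_IP (cball (0 :: 'a) 1) (\<lambda>x y. norm (x + y))"
  unfolding formula_has_IP_def
proof (intro exI conjI allI impI)
  show "range a \<subseteq> cball 0 1"
  proof clarsimp
    fix n
    show "norm (a n) \<le> 1"
      using upper[of "{n}" "\<lambda>_. 1"] by simp
  qed
  \<comment> \<open>This fixes the thresholds by unification: \<open>s = 1\<close> and
    \<open>r = 3 * \<theta> - 1\<close>. The gap \<open>s < r\<close> is exactly
    \<open>\<theta> > 2/3\<close>.\<close>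
  show "(1::real) < 3 * \<theta> - 1"
    using \<theta> by simp
  fix E F :: "nat set"
  assume "finite E \<and> finite F \<and> E \<inter> F = {}"
  then have fin: "finite (E \<union> F)" and disj: "E \<inter> F = {}"
    by auto
  \<comment> \<open>The value -1 also outside \<open>E \<union> F\<close> keeps the coefficients in
    [-1, 1] at every index, as \<open>upper\<close> demands.\<close>
  define \<sigma> :: "nat \<Rightarrow> real" where "\<sigma> k = (if k \<in> F then 1 else -1)" for k
  define b where "b = (\<Sum>k\<in>E \<union> F. \<sigma> k *\<^sub>R a k)"
  have split: "b = \<sigma> n *\<^sub>R a n + (\<Sum>k\<in>E \<union> F - {n}. \<sigma> k *\<^sub>R a k)" if "n \<in> E \<union> F" for n
    unfolding b_def by (rule sum.remove[OF fin that])
  show "\<exists>b\<in>cball 0 1. (\<forall>n\<in>E. norm (a n + b) \<le> 1) \<and> (\<forall>n\<in>F. 3 * \<theta> - 1 \<le> norm (a n + b))"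
  proof (intro bexI[of _ b] conjI ballI)
    show "b \<in> cball 0 1"
      using upper[OF fin, of \<sigma>] by (simp add: b_def \<sigma>_def)
  next
    fix n assume n: "n \<in> E"
    then have "\<sigma> n = -1"
      using disj by (auto simp: \<sigma>_def)
    then have "a n + b = (\<Sum>k\<in>E \<union> F - {n}. \<sigma> k *\<^sub>R a k)"
      using split[of n] n by simp
    then show "norm (a n + b) \<le> 1"
      using upper[of "E \<union> F - {n}" \<sigma>] fin by (simp add: \<sigma>_def)
  next
    fix n assume n: "n \<in> F"
    define w where "w = (\<Sum>k\<in>E \<union> F - {n}. \<sigma> k *\<^sub>R a k)"
    have b: "b = a n + w"
      using split[of n] n by (simp add: w_def \<sigma>_def)
    \<comment> \<open>All signs except the one at \<open>n\<close> are flipped, so that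
      \<open>t\<close> produces \<open>a n - w\<close>, which is 2 \<open>a n\<close> -
      \<open>b\<close>.\<close>
    define t where "t k = (if k = n then 1 else - \<sigma> k)" for k
    have "(\<Sum>k\<in>E \<union> F. t k *\<^sub>R a k) = t n *\<^sub>R a n + (\<Sum>k\<in>E \<union> F - {n}. t k *\<^sub>R a k)"
      using n fin by (intro sum.remove) auto
    also have "(\<Sum>k\<in>E \<union> F - {n}. t k *\<^sub>R a k) = - w"
      unfolding w_def sum_negf[symmetric] by (rule sum.cong) (auto simp: t_def)
    finally have "a n - w = (\<Sum>k\<in>E \<union> F. t k *\<^sub>R a k)"
      by (simp add: t_def)
    then have "norm (a n - w) \<le> 1"
      using upper[OF fin, of t] by (simp add: t_def \<sigma>_def)
    moreover have "3 *\<^sub>R a n = (a n + b) + (a n - w)"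
      using scaleR_left_distrib[of 2 1 "a n"] by (simp add: b scaleR_2)
    then have "3 * norm (a n) \<le> norm (a n + b) + norm (a n - w)"
      by (metis norm_scaleR norm_triangle_ineq abs_numeral)
    ultimately show "3 * \<theta> - 1 \<le> norm (a n + b)"
      using lower[of n] by simp
  qed
qed

text \<open>If \<open>y\<close> is the image of the unit vector basis, these are the images of the
  finitely supported vectors in the unit ball of \<open>c0\<close> that vanish before
  \<open>n\<close>.\<close>

definition tail_combinations :: "(nat \<Rightarrow> 'a::real_vector) \<Rightarrow> nat \<Rightarrow> 'a set" where
  "tail_combinations y n =
     {\<Sum>i\<in>A. c i *\<^sub>R y i | A c. finite A \<and> A \<subseteq> {n..} \<and> (\<forall>i. \<bar>c i\<bar> \<le> 1)}"

text \<open>Each index lies in at most one block, so coefficients are multiplied but never added,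
  and products of numbers in [-1, 1] stay there.\<close>

lemma sum_disjoint_blocks_in_tail_combinations:
  fixes y :: "nat \<Rightarrow> 'a::real_vector"
  assumes "finite G" and B: "\<And>k. finite (B k)" "\<And>k. B k \<subseteq> {n..}"
    and disj: "disjoint_family B"
    and t: "\<And>k. \<bar>t k\<bar> \<le> 1" and c: "\<And>k i. \<bar>c k i\<bar> \<le> 1"
  shows "(\<Sum>k\<in>G. t k *\<^sub>R (\<Sum>i\<in>B k. c k i *\<^sub>R y i)) \<in> tail_combinations y n"
proof -
  \<comment> \<open>The block that contains \<open>i\<close>. Off all blocks the choice is
    arbitrary, but the bound on \<open>d\<close> survives because \<open>t\<close> and
    \<open>c\<close> are bounded everywhere.\<close>
  define \<kappa> where "\<kappa> i = (SOME k. i \<in> B k)" for i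
  have \<kappa>: "\<kappa> i = k" if "i \<in> B k" for i k
  proof -
    have "i \<in> B (\<kappa> i)"
      unfolding \<kappa>_def using that by (rule someI)
    then show ?thesis
      using that disj by (auto simp: disjoint_family_on_def)
  qed
  define d where "d i = t (\<kappa> i) * c (\<kappa> i) i" for i
  have "(\<Sum>i\<in>(\<Union>k\<in>G. B k). d i *\<^sub>R y i) = (\<Sum>k\<in>G. \<Sum>i\<in>B k. d i *\<^sub>R y i)"
    using \<open>finite G\<close> B disj
    by (intro sum.UNION_disjoint) (auto simp: disjoint_family_on_def)
  also have "\<dots> = (\<Sum>k\<in>G. t k *\<^sub>R (\<Sum>i\<in>B k. c k i *\<^sub>R y i))"
    by (intro sum.cong) (simp_all add: scaleR_right.sum d_def \<kappa>)
  finally have "(\<Sum>k\<in>G. t k *\<^sub>R (\<Sum>i\<in>B k. c k i *\<^sub>R y i)) = (\<Sum>i\<in>(\<Union>k\<in>G. B k). d i *\<^sub>R y i)"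
    by simp
  moreover have "\<bar>d i\<bar> \<le> 1" for i
    unfolding d_def abs_mult by (intro mult_le_one t c) auto
  ultimately show ?thesis
    unfolding tail_combinations_def using \<open>finite G\<close> B
    by (intro CollectI exI[of _ "\<Union>k\<in>G. B k"] exI[of _ d]) auto
qed

text \<open>Greedy choice: every block starts beyond the end of the previous one.\<close>

lemma disjoint_blocks:
  fixes B :: "nat \<Rightarrow> nat set"
  assumes B: "\<And>n. finite (B n)" "\<And>n. B n \<subseteq> {n..}"
  obtains p :: "nat \<Rightarrow> nat" where "\<And>k. m \<le> p k" "disjoint_family (\<lambda>k. B (p k))"
proof -
  \<comment> \<open>Inserting \<open>n\<close> keeps \<open>Max\<close> meaningful for an empty
    block and makes \<open>p\<close> increase.\<close>
  define p where "p = rec_nat m (\<lambda>_ n. Suc (Max (insert n (B n))))"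
  have p0: "p 0 = m" and pSuc: "p (Suc k) = Suc (Max (insert (p k) (B (p k))))" for k
    by (simp_all add: p_def)
  have step: "i < p (Suc k)" if "i \<in> insert (p k) (B (p k))" for i k
    unfolding pSuc less_Suc_eq_le using that by (intro Max_ge) (simp_all add: B(1))
  have mono: "p k \<le> p l" if "k \<le> l" for k l
  proof (rule lift_Suc_mono_le[OF _ that])
    show "p j \<le> p (Suc j)" for j
      using step[of "p j" j] by simp
  qed
  have disj: "B (p k) \<inter> B (p l) = {}" if "k < l" for k l
  proof -
    have "p (Suc k) \<le> p l"
      using that by (intro mono) simp
    then show ?thesis
      using step[of _ k] B(2)[of "p l"] by fastforce
  qed
  have "disjoint_family (\<lambda>k. B (p k))"
    unfolding disjoint_family_on_def using disj by (metis Int_commute linorder_neqE_nat)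
  moreover have "m \<le> p k" for k
    using mono[of 0 k] p0 by simp
  ultimately show thesis
    using that by blast
qed

lemma james_distortion:
  fixes y :: "nat \<Rightarrow> 'a::real_normed_vector"
  assumes bound: "\<And>v. v \<in> tail_combinations y 0 \<Longrightarrow> norm v \<le> M"
    and y: "\<And>n. \<delta> \<le> norm (y n)" "\<delta> > 0" and \<theta>: "0 < \<theta>" "\<theta> < 1"
  obtains a :: "nat \<Rightarrow> 'a" where "\<And>n. \<theta> \<le> norm (a n)"
    "\<And>G t. finite G \<Longrightarrow> (\<And>k. \<bar>t k\<bar> \<le> 1) \<Longrightarrow> norm (\<Sum>k\<in>G. t k *\<^sub>R a k) \<le> 1"
proof -
  let ?D = "\<lambda>n. norm ` tail_combinations y n"
  define K where "K n = Sup (?D n)" for n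
  have "tail_combinations y n \<subseteq> tail_combinations y 0" for n
    unfolding tail_combinations_def by auto
  then have bdd: "bdd_above (?D n)" for n
    using bound by (intro bdd_aboveI[of _ M]) auto
  have y_in: "y n \<in> tail_combinations y n" for n
    unfolding tail_combinations_def
    by (intro CollectI exI[of _ "{n}"] exI[of _ "\<lambda>_. 1"]) auto
  have K_\<delta>: "\<delta> \<le> K n" for n
    unfolding K_def using y(1)[of n] y_in by (intro cSup_upper2[OF _ _ bdd]) auto
  have bdd_K: "bdd_below (range K)"
    using K_\<delta> by (intro bdd_belowI[of _ \<delta>]) auto
  have pos: "0 < (INF n. K n)"
    using K_\<delta> y(2) by (intro less_le_trans[OF _ cINF_greatest]) auto
  then have "(INF n. K n) < (INF n. K n) / \<theta>"
    using \<theta> by (simp add: field_simps)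
  \<comment> \<open>With this \<open>m\<close>, the number \<open>\<theta> * K m\<close> lies below
    the infimum, hence below every \<open>K n\<close>. So the single normaliser \<open>K m\<close>
    serves all blocks: starting at \<open>m\<close> or later, they combine to norm at most
    \<open>K m\<close>, while each exceeds \<open>\<theta> * K m\<close>.\<close>
  then obtain m where m: "K m < (INF n. K n) / \<theta>"
    using cINF_less_iff[OF _ bdd_K] by auto
  have "\<exists>A c. finite A \<and> A \<subseteq> {n..} \<and> (\<forall>i. \<bar>c i\<bar> \<le> 1) \<and>
      \<theta> * K m < norm (\<Sum>i\<in>A. c i *\<^sub>R y i)" for n
  proof -
    have "\<theta> * K m < (INF n. K n)"
      using m \<theta> by (simp add: field_simps)
    also have "\<dots> \<le> K n"
      by (intro cINF_lower bdd_K) auto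
    finally obtain v where "v \<in> tail_combinations y n" "\<theta> * K m < norm v"
      unfolding K_def using y_in bdd by (subst (asm) less_cSup_iff) auto
    then show ?thesis
      unfolding tail_combinations_def by blast
  qed
  then obtain B c where B: "\<And>n. finite (B n)" "\<And>n. B n \<subseteq> {n..}"
    and c: "\<And>n i. \<bar>c n i\<bar> \<le> 1"
    and large: "\<And>n. \<theta> * K m < norm (\<Sum>i\<in>B n. c n i *\<^sub>R y i)"
    by metis
  obtain p :: "nat \<Rightarrow> nat" where p: "\<And>k. m \<le> p k" "disjoint_family (\<lambda>k. B (p k))"
    using disjoint_blocks[where m = m, OF B] by blast
  define u where "u k = (\<Sum>i\<in>B (p k). c (p k) i *\<^sub>R y i)" for k
  have Km: "K m > 0"
    using K_\<delta>[of m] y(2) by linarith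
  show thesis
  proof (rule that[of "\<lambda>k. inverse (K m) *\<^sub>R u k"])
    fix n
    show "\<theta> \<le> norm (inverse (K m) *\<^sub>R u n)"
      using large[of "p n"] Km by (simp add: u_def field_simps)
  next
    fix G :: "nat set" and t :: "nat \<Rightarrow> real"
    assume G: "finite G" and t: "\<And>k. \<bar>t k\<bar> \<le> 1"
    have "B (p k) \<subseteq> {m..}" for k
      using B(2)[of "p k"] p(1)[of k] by auto
    then have "(\<Sum>k\<in>G. t k *\<^sub>R u k) \<in> tail_combinations y m"
      unfolding u_def using G t c B p
      by (intro sum_disjoint_blocks_in_tail_combinations) auto
    then have le: "norm (\<Sum>k\<in>G. t k *\<^sub>R u k) \<le> K m"
      unfolding K_def by (intro cSup_upper bdd imageI)
    have "(\<Sum>k\<in>G. t k *\<^sub>R inverse (K m) *\<^sub>R u k) = inverse (K m) *\<^sub>R (\<Sum>k\<in>G. t k *\<^sub>R u k)"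
      by (simp add: scaleR_right.sum mult.commute)
    then show "norm (\<Sum>k\<in>G. t k *\<^sub>R inverse (K m) *\<^sub>R u k) \<le> 1"
      using le Km by (simp add: field_simps)
  qed
qed

lemma c0_unit_vectors:
  obtains e where "\<And>i. e i \<in> c0" "\<And>i n. apply_bcontfun (e i) n = (if n = i then 1 else 0)"
proof -
  have "\<exists>x\<in>c0. apply_bcontfun x = (\<lambda>n. if n = i then 1 else 0)" for i
  proof -
    have "\<forall>\<^sub>F n in sequentially. (if n = i then 1 else 0 :: real) = 0"
      using eventually_gt_at_top[of i] by eventually_elim auto
    then have "(\<lambda>n. if n = i then 1 else 0 :: real) \<longlonglongrightarrow> 0"
      by (rule tendsto_eventually)
    then show ?thesis
      using in_range_c0 by metis
  qed
  then show thesis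
    using that by metis
qed

lemma apply_bcontfun_sum:
  "apply_bcontfun (\<Sum>i\<in>A. x i) n = (\<Sum>i\<in>A. apply_bcontfun (x i) n)"
  by (induction A rule: infinite_finite_induct)
    (simp_all add: plus_bcontfun.rep_eq zero_bcontfun.rep_eq)

text \<open>The upper bound comes from continuity of \<open>f\<close> at 0 and scaling, the lower
  one from continuity of \<open>g\<close> at 0, since \<open>g\<close> sends \<open>f (e n)\<close>
  back to a vector of norm at least 1.\<close>

lemma linearly_homeomorphic_c0_imp_basis:
  fixes S :: "'a::real_normed_vector set"
  assumes "linearly_homeomorphic c0 S"
  obtains y :: "nat \<Rightarrow> 'a" and M \<delta> where "\<And>v. v \<in> tail_combinations y 0 \<Longrightarrow> norm v \<le> M"
    "\<And>n. \<delta> \<le> norm (y n)" "\<delta> > 0"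
proof -
  obtain f :: "(nat \<Rightarrow>\<^sub>C real) \<Rightarrow> 'a" and g where hom: "homeomorphism c0 S f g"
    and add: "\<And>x y. x \<in> c0 \<Longrightarrow> y \<in> c0 \<Longrightarrow> f (x + y) = f x + f y"
    and scale: "\<And>c x. x \<in> c0 \<Longrightarrow> f (c *\<^sub>R x) = c *\<^sub>R f x"
    using assms unfolding linearly_homeomorphic_def by blast
  have zero_in: "0 \<in> c0"
    by (rule subspace_0[OF subspace_c0])
  have f0: "f 0 = 0"
    using scale[OF zero_in, of 0] by simp
  have gf: "g (f x) = x" and fS: "f x \<in> S" if "x \<in> c0" for x
    using hom that by (auto simp: homeomorphism_def)
  have cont: "continuous_on c0 f" "continuous_on S g"
    using hom by (auto simp: homeomorphism_def)
  obtain \<eta> where \<eta>: "\<eta> > 0" "\<And>x. x \<in> c0 \<Longrightarrow> norm x < \<eta> \<Longrightarrow> norm (f x) < 1"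
    using cont(1) zero_in f0 unfolding continuous_on_iff
    by (metis dist_0_norm dist_commute zero_less_one)
  have "g 0 = 0" "0 \<in> S"
    using gf[OF zero_in] fS[OF zero_in] f0 by simp_all
  then obtain \<delta> where \<delta>: "\<delta> > 0" "\<And>z. z \<in> S \<Longrightarrow> norm z < \<delta> \<Longrightarrow> norm (g z) < 1"
    using cont(2) unfolding continuous_on_iff
    by (metis dist_0_norm dist_commute zero_less_one)
  obtain e where e: "\<And>i. e i \<in> c0"
    "\<And>i n. apply_bcontfun (e i) n = (if n = i then 1 else 0)"
    using c0_unit_vectors by metis
  have f_sum: "f (\<Sum>i\<in>A. c i *\<^sub>R e i) = (\<Sum>i\<in>A. c i *\<^sub>R f (e i))" for A c
    by (induction A rule: infinite_finite_induct)
      (simp_all add: f0 add scale e subspace_c0 subspace_sum subspace_scale)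
  show thesis
  proof (rule that[of "\<lambda>i. f (e i)" "2 / \<eta>" \<delta>])
    fix v assume "v \<in> tail_combinations (\<lambda>i. f (e i)) 0"
    then obtain A c where A: "finite A" and c: "\<And>i. \<bar>c i\<bar> \<le> 1"
      and v: "v = f (\<Sum>i\<in>A. c i *\<^sub>R e i)"
      unfolding tail_combinations_def f_sum by blast
    define x where "x = (\<Sum>i\<in>A. c i *\<^sub>R e i)"
    have x: "x \<in> c0"
      unfolding x_def by (intro subspace_sum subspace_scale subspace_c0 e)
    \<comment> \<open>Here the supremum norm enters: the unit vectors do not overlap, so the norm of
      \<open>x\<close> is governed by the largest coefficient, not by their sum.\<close>
    have "apply_bcontfun x n = (if n \<in> A then c n else 0)" for n
      using A by (simp add: x_def apply_bcontfun_sum scaleR_bcontfun.rep_eq e if_distrib cong: if_cong)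
    then have "norm x \<le> 1"
      using c by (intro norm_bound) simp
    \<comment> \<open>The factor 1/2 gives the strict inequality even if \<open>x\<close> has norm
      1; undoing the scaling yields the bound \<open>2 / \<eta>\<close>.\<close>
    then have "norm ((\<eta> / 2) *\<^sub>R x) < \<eta>"
      using \<eta>(1) mult_left_mono[of "norm x" 1 \<eta>] by simp
    then have "norm (f ((\<eta> / 2) *\<^sub>R x)) < 1"
      using x by (intro \<eta> subspace_scale subspace_c0)
    then show "norm v \<le> 2 / \<eta>"
      using \<eta>(1) x v by (simp add: scale x_def field_simps)
  next
    fix n
    have "1 \<le> norm (e n)"
      using norm_bounded[of "e n" n] by (simp add: e)
    then show "\<delta> \<le> norm (f (e n))"
      using \<delta>(2)[of "f (e n)"] gf fS e(1) by (metis leD leI)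
  qed (use \<delta> in auto)
qed

theorem mainTheorem5:
  assumes "\<exists>S :: 'a::banach set. subspace S \<and> linearly_homeomorphic c0 S"
  shows "banach_has_IP TYPE('a)"
proof -
  obtain y :: "nat \<Rightarrow> 'a" and M \<delta> where y: "\<And>v. v \<in> tail_combinations y 0 \<Longrightarrow> norm v \<le> M"
    "\<And>n. \<delta> \<le> norm (y n)" "\<delta> > 0"
    using assms linearly_homeomorphic_c0_imp_basis by metis
  \<comment> \<open>Any constant strictly between 2/3 and 1 would do: the distortion argument needs
    it below 1, the gap between the thresholds needs it above 2/3.\<close>
  obtain a :: "nat \<Rightarrow> 'a" where a: "\<And>n. 3/4 \<le> norm (a n)"
    "\<And>G t. finite G \<Longrightarrow> (\<And>k. \<bar>t k\<bar> \<le> 1) \<Longrightarrow> norm (\<Sum>k\<in>G. t k *\<^sub>R a k) \<le> 1"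
    using james_distortion[where y = y and \<theta> = "3/4", OF y] by auto
  then show ?thesis
    unfolding banach_has_IP_def by (intro formula_has_IP_norm_add[of a "3/4"]) auto
qed

end
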